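(* Let $(L,A,\cdot,\ell)$ be a left-symmetric Rinehart algebra over a field $\mathbb K$ of characteristic zero, let $(M;\rho,\mu)$ be a representation of it, and let $T:M\to L$ be a linear map. Then the following statements are equivalent: (i) $T$ is an $\mathcal O$-operator on $(L,A,\cdot,\ell)$ associated to $(M;\rho,\mu)$. (ii) The map $\mathcal N_T=\begin{pmatrix}0&T\\0&\mathrm{Id}\end{pmatrix}$, i.e. $\mathcal N_T(x+m)=T(m)+m$, is a Nijenhuis operator on the semidirect product left-symmetric Rinehart algebra $(L\oplus M,\cdot_{L\oplus M})$. (iii) The map $N_T=\begin{pmatrix}0&T\\0&0\end{pmatrix}$, i.e. $N_T(x+m)=T(m)$, is a Nijenhuis operator on $(L\oplus M,\cdot_{L\oplus M})$.
   Context: All vector spaces are over a field $\mathbb K$ of characteristic zero. A left-symmetric Rinehart algebra is a quadruple $(L,A,\cdot,\ell)$ where $A$ is an associative commutative $\mathbb K$-algebra, $L$ is an $A$-module with a bilinear product satisfying $(x\cdot y)\cdot z-x\cdot(y\cdot z)=(y\cdot x)\cdot z-y\cdot(x\cdot z)$, and $\ell:L\to \mathrm{Der}(A)$ is a linear map such that $\ell(x\cdot y-y\cdot x)=\ell(x)\ell(y)-\ell(y)\ell(x)$, $\ell(ax)=a\ell(x)$, $x\cdot(ay)=\ell(x)(a)\,y+a(x\cdot y)$, and $(ax)\cdot y=a(x\cdot y)$ for all $a\in A$, $x,y,z\in L$. Write $[x,y]=x\cdot y-y\cdot x$. A representation $(M;\rho,\mu)$ of $(L,A,\cdot,\ell)$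 consists of an $A$-module $M$, a linear map $\rho:L\to\mathrm{End}_{\mathbb K}(M)$ with $\rho([x,y])=\rho(x)\rho(y)-\rho(y)\rho(x)$, $\rho(ax)m=a\rho(x)m$, $\rho(x)(am)=a\rho(x)m+\ell(x)(a)m$, and a linear map $\mu:L\to \mathrm{End}_{\mathbb K}(M)$ with $\mu(ax)m=a\mu(x)m=\mu(x)(am)$ and $\rho(x)\mu(y)-\mu(y)\rho(x)=\mu(x\cdot y)-\mu(y)\mu(x)$. The semidirect product is $L\oplus M$ with $(x_1+m_1)\cdot_{L\oplus M}(x_2+m_2)=x_1\cdot x_2+\rho(x_1)m_2+\mu(x_2)m_1$ and $\ell_{L\oplus M}(x+m)=\ell(x)$; it is a left-symmetric Rinehart algebra over $A$. An $\mathcal O$-operator associated to $(M;\rho,\mu)$ is a linear map $T:M\to L$ with $T(au)=aT(u)$ and $T(u)\cdot T(v)=T(\rho(T(u))(v)+\mu(T(v))(u))$ for all $u,v\in M$, $a\in A$. A Nijenhuis operator on a left-symmetric Rinehart algebra $(L,A,\cdot,\ell)$ is an $A$-linear map $N:L\to L$ with $N(x)\cdot N(y)-N(x\cdot N(y))-N(N(x)\cdot y)+N^2(x\cdot y)=0$ for all $x,y\in L$. *)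

theory Defs
  imports Complex_Main "HOL-Library.Product_Plus"
begin

text \<open>
  The field of characteristic zero, the algebra \<open>A\<close> and the spaces \<open>L\<close> and \<open>M\<close> are the types
  \<open>'k\<close>, \<open>'a\<close>, \<open>'l\<close>, \<open>'m\<close>; the scalar multiplications by \<open>'k\<close> are parameters, as in
  \<^locale>\<open>vector_space\<close>. The algebra \<open>A\<close> is not required to have a unit (\<^class>\<open>comm_ring\<close> has none),
  and so its modules are \<open>'k\<close>-vector spaces with a \<open>'k\<close>-bilinear associative action of \<open>A\<close>.
  If \<open>A\<close> has a unit, every unital \<open>A\<close>-module carries such a structure, with \<open>k x = (k 1) x\<close>.
\<close>

locale commutative_algebra = vector_space scaleA
  for scaleA :: "'k::field_char_0 \<Rightarrow> 'a::comm_ring \<Rightarrow> 'a" +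
  assumes scale_mult: "scaleA k (a * b) = scaleA k a * b"

definition derivation ::
  "('k::field_char_0 \<Rightarrow> 'a::comm_ring \<Rightarrow> 'a) \<Rightarrow> ('a \<Rightarrow> 'a) \<Rightarrow> bool" where
  "derivation scaleA D \<longleftrightarrow>
     Vector_Spaces.linear scaleA scaleA D \<and> (\<forall>a b. D (a * b) = D a * b + a * D b)"

locale algebra_module =
  A: commutative_algebra scaleA + V: vector_space scaleV
  for scaleA :: "'k::field_char_0 \<Rightarrow> 'a::comm_ring \<Rightarrow> 'a"
    and scaleV :: "'k \<Rightarrow> 'v::ab_group_add \<Rightarrow> 'v" +
  fixes act :: "'a \<Rightarrow> 'v \<Rightarrow> 'v"
  assumes act_linear_left: "Vector_Spaces.linear scaleA scaleV (\<lambda>a. act a x)"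
    and act_linear_right: "Vector_Spaces.linear scaleV scaleV (act a)"
    and act_mult: "act (a * b) x = act a (act b x)"

locale left_symmetric_rinehart_algebra = algebra_module scaleA scaleL actL
  for scaleA :: "'k::field_char_0 \<Rightarrow> 'a::comm_ring \<Rightarrow> 'a"
    and scaleL :: "'k \<Rightarrow> 'l::ab_group_add \<Rightarrow> 'l"
    and actL :: "'a \<Rightarrow> 'l \<Rightarrow> 'l" +
  fixes prd :: "'l \<Rightarrow> 'l \<Rightarrow> 'l"  (infixl \<open>\<cdot>\<close> 70)
    and anchor :: "'l \<Rightarrow> 'a \<Rightarrow> 'a"  (\<open>\<l>\<close>)
  assumes prd_linear_left: "Vector_Spaces.linear scaleL scaleL (\<lambda>x. x \<cdot> y)"
    and prd_linear_right: "Vector_Spaces.linear scaleL scaleL (\<lambda>y. x \<cdot> y)"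
    and left_symmetric: "(x \<cdot> y) \<cdot> z - x \<cdot> (y \<cdot> z) = (y \<cdot> x) \<cdot> z - y \<cdot> (x \<cdot> z)"
    and anchor_derivation: "derivation scaleA (\<l> x)"
    and anchor_linear: "Vector_Spaces.linear scaleL scaleA (\<lambda>x. \<l> x a)"
    and anchor_commutator: "\<l> (x \<cdot> y - y \<cdot> x) a = \<l> x (\<l> y a) - \<l> y (\<l> x a)"
    and anchor_act: "\<l> (actL a x) b = a * \<l> x b"
    and prd_act_right: "x \<cdot> actL a y = actL (\<l> x a) y + actL a (x \<cdot> y)"
    and prd_act_left: "actL a x \<cdot> y = actL a (x \<cdot> y)"

locale rinehart_representation =
  left_symmetric_rinehart_algebra scaleA scaleL actL prd anchor +
  M: algebra_module scaleA scaleM actM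
  for scaleA :: "'k::field_char_0 \<Rightarrow> 'a::comm_ring \<Rightarrow> 'a"
    and scaleL :: "'k \<Rightarrow> 'l::ab_group_add \<Rightarrow> 'l"
    and actL :: "'a \<Rightarrow> 'l \<Rightarrow> 'l"
    and prd :: "'l \<Rightarrow> 'l \<Rightarrow> 'l"  (infixl \<open>\<cdot>\<close> 70)
    and anchor :: "'l \<Rightarrow> 'a \<Rightarrow> 'a"  (\<open>\<l>\<close>)
    and scaleM :: "'k \<Rightarrow> 'm::ab_group_add \<Rightarrow> 'm"
    and actM :: "'a \<Rightarrow> 'm \<Rightarrow> 'm" +
  fixes \<rho> \<mu> :: "'l \<Rightarrow> 'm \<Rightarrow> 'm"
  assumes rho_endo: "Vector_Spaces.linear scaleM scaleM (\<rho> x)"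
    and rho_linear: "Vector_Spaces.linear scaleL scaleM (\<lambda>x. \<rho> x m)"
    and rho_commutator: "\<rho> (x \<cdot> y - y \<cdot> x) m = \<rho> x (\<rho> y m) - \<rho> y (\<rho> x m)"
    and rho_act_left: "\<rho> (actL a x) m = actM a (\<rho> x m)"
    and rho_act_right: "\<rho> x (actM a m) = actM a (\<rho> x m) + actM (\<l> x a) m"
    and mu_endo: "Vector_Spaces.linear scaleM scaleM (\<mu> x)"
    and mu_linear: "Vector_Spaces.linear scaleL scaleM (\<lambda>x. \<mu> x m)"
    and mu_act_left: "\<mu> (actL a x) m = actM a (\<mu> x m)"
    and mu_act_right: "\<mu> x (actM a m) = actM a (\<mu> x m)"
    and rho_mu: "\<rho> x (\<mu> y m) - \<mu> y (\<rho> x m) = \<mu> (x \<cdot> y) m - \<mu> y (\<mu> x m)"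

text \<open>
  The space \<open>L \<oplus> M\<close> is the type \<open>'l \<times> 'm\<close> with componentwise addition. The next constant serves
  both for the scalar multiplication and for the action of \<open>A\<close>.
\<close>

definition direct_sum_action ::
  "('c \<Rightarrow> 'l \<Rightarrow> 'l) \<Rightarrow> ('c \<Rightarrow> 'm \<Rightarrow> 'm) \<Rightarrow> 'c \<Rightarrow> 'l \<times> 'm \<Rightarrow> 'l \<times> 'm" where
  "direct_sum_action f g c = map_prod (f c) (g c)"

definition semidirect_prd ::
  "('l \<Rightarrow> 'l \<Rightarrow> 'l) \<Rightarrow> ('l \<Rightarrow> 'm \<Rightarrow> 'm) \<Rightarrow> ('l \<Rightarrow> 'm \<Rightarrow> 'm)
    \<Rightarrow> 'l \<times> 'm::ab_group_add \<Rightarrow> 'l \<times> 'm \<Rightarrow> 'l \<times> 'm" where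
  "semidirect_prd prd \<rho> \<mu> = (\<lambda>(x, m) (y, n). (prd x y, \<rho> x n + \<mu> y m))"

definition semidirect_anchor :: "('l \<Rightarrow> 'a \<Rightarrow> 'a) \<Rightarrow> 'l \<times> 'm \<Rightarrow> 'a \<Rightarrow> 'a" where
  "semidirect_anchor anchor = (\<lambda>(x, m). anchor x)"

locale O_operator =
  rinehart_representation scaleA scaleL actL prd anchor scaleM actM \<rho> \<mu>
  for scaleA :: "'k::field_char_0 \<Rightarrow> 'a::comm_ring \<Rightarrow> 'a"
    and scaleL :: "'k \<Rightarrow> 'l::ab_group_add \<Rightarrow> 'l"
    and actL :: "'a \<Rightarrow> 'l \<Rightarrow> 'l"
    and prd :: "'l \<Rightarrow> 'l \<Rightarrow> 'l"  (infixl \<open>\<cdot>\<close> 70)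
    and anchor :: "'l \<Rightarrow> 'a \<Rightarrow> 'a"
    and scaleM :: "'k \<Rightarrow> 'm::ab_group_add \<Rightarrow> 'm"
    and actM :: "'a \<Rightarrow> 'm \<Rightarrow> 'm"
    and \<rho> \<mu> :: "'l \<Rightarrow> 'm \<Rightarrow> 'm" +
  fixes T :: "'m \<Rightarrow> 'l"
  assumes T_linear: "Vector_Spaces.linear scaleM scaleL T"
    and T_act: "T (actM a u) = actL a (T u)"
    and T_prd: "T u \<cdot> T v = T (\<rho> (T u) v + \<mu> (T v) u)"

locale nijenhuis_operator =
  left_symmetric_rinehart_algebra scaleA scaleL actL prd anchor
  for scaleA :: "'k::field_char_0 \<Rightarrow> 'a::comm_ring \<Rightarrow> 'a"
    and scaleL :: "'k \<Rightarrow> 'l::ab_group_add \<Rightarrow> 'l"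
    and actL :: "'a \<Rightarrow> 'l \<Rightarrow> 'l"
    and prd :: "'l \<Rightarrow> 'l \<Rightarrow> 'l"  (infixl \<open>\<cdot>\<close> 70)
    and anchor :: "'l \<Rightarrow> 'a \<Rightarrow> 'a" +
  fixes N :: "'l \<Rightarrow> 'l"
  assumes N_linear: "Vector_Spaces.linear scaleL scaleL N"
    and N_act: "N (actL a x) = actL a (N x)"
    and N_prd: "N x \<cdot> N y - N (x \<cdot> N y) - N (N x \<cdot> y) + N (N (x \<cdot> y)) = 0"

end

theory Submission
  imports Defs
begin

text \<open>
  On \<open>L \<oplus> M\<close> the Nijenhuis torsion of either map at \<open>(x, m)\<close>, \<open>(y, n)\<close> is
  \<open>T m \<cdot> T n - T (\<rho> (T m) n + \<mu> (T n) m)\<close> in the component \<open>L\<close> and \<open>0\<close> in the component \<open>M\<close>: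
  all terms with \<open>x\<close> or \<open>y\<close> cancel.
\<close>

lemma vector_space_direct_sum:
  assumes "vector_space s" and "vector_space t"
  shows "vector_space (direct_sum_action s t)"
proof -
  interpret s: vector_space s by fact
  interpret t: vector_space t by fact
  show ?thesis
    by unfold_locales
      (auto simp: direct_sum_action_def s.scale_right_distrib s.scale_left_distrib
        t.scale_right_distrib t.scale_left_distrib)
qed

text \<open>Needed because \<open>nijenhuis_operator\<close> extends the algebra locale, so being
  Nijenhuis includes the algebra axioms of the semidirect product. The anchor sees only
  \<open>L\<close>, the \<open>L\<close>-components repeat the axioms of \<open>L\<close>, and the
  \<open>M\<close>-components reduce to those of the representation.\<close>

lemma (in rinehart_representation) semidirect_product:
  "left_symmetric_rinehart_algebra scaleA (direct_sum_action scaleL scaleM)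
    (direct_sum_action actL actM) (semidirect_prd prd \<rho> \<mu>) (semidirect_anchor anchor)"
proof -
  have LM: "vector_space (direct_sum_action scaleL scaleM)"
    by (intro vector_space_direct_sum V.vector_space_axioms M.V.vector_space_axioms)
  note linear = Vector_Spaces.linear_iff
  note hom = act_linear_left[unfolded linear] act_linear_right[unfolded linear]
    M.act_linear_left[unfolded linear] M.act_linear_right[unfolded linear]
    prd_linear_left[unfolded linear] prd_linear_right[unfolded linear]
    anchor_linear[unfolded linear]
    rho_endo[unfolded linear] rho_linear[unfolded linear]
    mu_endo[unfolded linear] mu_linear[unfolded linear]
  note scale_distrib = V.scale_right_distrib M.V.scale_right_distrib
    V.scale_left_distrib M.V.scale_left_distrib
  interpret LM: algebra_module scaleA "direct_sum_action scaleL scaleM" "direct_sum_action actL actM"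
    by (rule algebra_module.intro[OF A.commutative_algebra_axioms LM], unfold_locales)
      (auto simp: linear direct_sum_action_def hom LM act_mult M.act_mult scale_distrib
        A.vector_space_axioms)
  \<comment> \<open>\<open>hom\<close> provides additivity but no rule for differences, so
    \<open>x \<cdot> y\<close> is split as the commutator plus \<open>y \<cdot> x\<close>. As a
    rewrite rule the result would swap \<open>x\<close> and \<open>y\<close> forever; it is used
    below only at fixed arguments.\<close>
  have rho_prd: "\<rho> (x \<cdot> y) m = \<rho> (y \<cdot> x) m + \<rho> x (\<rho> y m) - \<rho> y (\<rho> x m)" for x y m
  proof -
    have "\<rho> (x \<cdot> y) m = \<rho> ((x \<cdot> y - y \<cdot> x) + y \<cdot> x) m" by simp
    also have "\<dots> = \<rho> (x \<cdot> y - y \<cdot> x) m + \<rho> (y \<cdot> x) m" by (simp only: hom)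
    finally show ?thesis by (simp add: rho_commutator algebra_simps)
  qed
  have mu_prd: "\<mu> (x \<cdot> y) m = \<rho> x (\<mu> y m) - \<mu> y (\<rho> x m) + \<mu> y (\<mu> x m)" for x y m
    by (simp add: rho_mu)
  show ?thesis
  proof (intro left_symmetric_rinehart_algebra.intro left_symmetric_rinehart_algebra_axioms.intro
      LM.algebra_module_axioms, goal_cases)
    \<comment> \<open>Left symmetry. In the \<open>M\<close>-component the terms in \<open>p\<close>
      agree by \<open>rho_prd\<close>, those in \<open>n\<close> by \<open>mu_prd\<close> at
      \<open>x1\<close>, \<open>z1\<close>, and those in \<open>m\<close> by \<open>mu_prd\<close>
      at \<open>y1\<close>, \<open>z1\<close>.\<close>
    case (3 x y z)
    obtain x1 m y1 n z1 p where [simp]: "x = (x1, m)" "y = (y1, n)" "z = (z1, p)"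
      by (metis prod.exhaust)
    show ?case
      using left_symmetric[of x1 y1 z1]
      by (simp add: semidirect_prd_def hom mu_prd rho_prd[of x1 y1])
  qed (auto simp: linear direct_sum_action_def semidirect_prd_def semidirect_anchor_def
      hom LM A.vector_space_axioms anchor_derivation anchor_commutator anchor_act
      prd_act_right prd_act_left rho_act_left rho_act_right mu_act_left mu_act_right
      scale_distrib)
qed

theorem proposition7p5:
  fixes scaleA :: "'k::field_char_0 \<Rightarrow> 'a::comm_ring \<Rightarrow> 'a"
    and scaleL :: "'k \<Rightarrow> 'l::ab_group_add \<Rightarrow> 'l"
    and actL :: "'a \<Rightarrow> 'l \<Rightarrow> 'l"
    and prd :: "'l \<Rightarrow> 'l \<Rightarrow> 'l"
    and anchor :: "'l \<Rightarrow> 'a \<Rightarrow> 'a"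
    and scaleM :: "'k \<Rightarrow> 'm::ab_group_add \<Rightarrow> 'm"
    and actM :: "'a \<Rightarrow> 'm \<Rightarrow> 'm"
    and \<rho> \<mu> :: "'l \<Rightarrow> 'm \<Rightarrow> 'm"
    and T :: "'m \<Rightarrow> 'l"
  assumes "left_symmetric_rinehart_algebra scaleA scaleL actL prd anchor"
    and "rinehart_representation scaleA scaleL actL prd anchor scaleM actM \<rho> \<mu>"
    and "Vector_Spaces.linear scaleM scaleL T"
  shows "(O_operator scaleA scaleL actL prd anchor scaleM actM \<rho> \<mu> T \<longleftrightarrow>
          nijenhuis_operator scaleA (direct_sum_action scaleL scaleM) (direct_sum_action actL actM)
            (semidirect_prd prd \<rho> \<mu>) (semidirect_anchor anchor) (\<lambda>(x, m). (T m, m))) \<and>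
         (O_operator scaleA scaleL actL prd anchor scaleM actM \<rho> \<mu> T \<longleftrightarrow>
          nijenhuis_operator scaleA (direct_sum_action scaleL scaleM) (direct_sum_action actL actM)
            (semidirect_prd prd \<rho> \<mu>) (semidirect_anchor anchor) (\<lambda>(x, m). (T m, 0)))"
proof -
  interpret rinehart_representation scaleA scaleL actL prd anchor scaleM actM \<rho> \<mu>
    by fact
  interpret SD: left_symmetric_rinehart_algebra scaleA "direct_sum_action scaleL scaleM"
    "direct_sum_action actL actM" "semidirect_prd prd \<rho> \<mu>" "semidirect_anchor anchor"
    by (rule semidirect_product)
  note linear = Vector_Spaces.linear_iff
  have T_hom: "T (u + v) = T u + T v" "T (scaleM c u) = scaleL c (T u)" for u v c
    using assms(3) by (auto simp: linear)
  \<comment> \<open>These zeros are for the operator with values \<open>(T m, 0)\<close>: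
    \<open>T_0\<close> makes its square vanish, \<open>rho_0\<close> and \<open>mu_0\<close>
    simplify products with its values, and \<open>act_0\<close> makes it commute with the action of
    \<open>A\<close>.\<close>
  have T_0: "T 0 = 0"
    using T_hom(1)[of 0 0] by simp
  have rho_0: "\<rho> x 0 = 0" and mu_0: "\<mu> x 0 = 0" for x
    using rho_endo[of x] mu_endo[of x] by (auto simp: linear) (metis add_cancel_right_right)+
  have act_0: "actM a 0 = 0" for a
    using M.act_linear_right[of a] by (auto simp: linear) (metis add_cancel_right_right)
  have O_iff: "O_operator scaleA scaleL actL prd anchor scaleM actM \<rho> \<mu> T \<longleftrightarrow>
    (\<forall>a u. T (actM a u) = actL a (T u)) \<and>
    (\<forall>u v. prd (T u) (T v) = T (\<rho> (T u) v + \<mu> (T v) u))"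
    using rinehart_representation_axioms assms(3)
    by (auto simp: O_operator_def O_operator_axioms_def)
  \<comment> \<open>The two operators differ only in \<open>e\<close>, and the right-hand side, that
    of \<open>O_iff\<close>, is free of \<open>e\<close>. For the identity the operator is
    idempotent, so the square term cancels \<open>T (\<rho> x n)\<close> and
    \<open>T (\<mu> y m)\<close>; for \<open>e\<close> zero these terms never arise and the square
    is zero.\<close>
  have N_iff: "nijenhuis_operator scaleA (direct_sum_action scaleL scaleM)
      (direct_sum_action actL actM) (semidirect_prd prd \<rho> \<mu>) (semidirect_anchor anchor)
      (\<lambda>(x, m). (T m, e m)) \<longleftrightarrow>
    (\<forall>a u. T (actM a u) = actL a (T u)) \<and>
    (\<forall>u v. prd (T u) (T v) = T (\<rho> (T u) v + \<mu> (T v) u))"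
    if "e = (\<lambda>m. m) \<or> e = (\<lambda>m. 0)" for e
    unfolding nijenhuis_operator_def nijenhuis_operator_axioms_def
    using that SD.left_symmetric_rinehart_algebra_axioms
    by (auto simp: linear SD.V.vector_space_axioms direct_sum_action_def semidirect_prd_def
        T_hom T_0 rho_0 mu_0 act_0 zero_prod_def diff_eq_eq)
  show ?thesis
    using N_iff[of "\<lambda>m. m"] N_iff[of "\<lambda>m. 0"] O_iff by simp
qed

end
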